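(* Let $n<\omega$, let $\kappa_0<\cdots<\kappa_n$ be regular cardinals, let $X$ be a $T_3$ space, and let $p\in X$. If $\mathrm{Nbhd}(p,X)$ is cofinally equivalent to $\prod_{i\leq n}\kappa_i$, then $c(X)\geq\kappa_n$.
   Context: $\mathrm{Nbhd}(p,X)$ is the neighborhood filter of $p$ in $X$, i.e. the set of all $U\subseteq X$ such that $p$ is in the interior of $U$, preordered by containment $\supseteq$ (smaller neighborhoods are greater). A subset $C$ of a preorder $P$ is cofinal if every element of $P$ is $\leq$ some element of $C$. Preorders $P$ and $Q$ are cofinally equivalent if there is a preorder $R$ such that $P$ and $Q$ are order isomorphic to cofinal subsets of $R$. Each cardinal $\kappa_i$ has its usual well-order and the product $\prod_{i\le n}\kappa_i$ has the coordinatewise order. By convention, $1$ is the unique finite regular cardinal. A cellular family in $X$ is a pairwise disjoint family of open subsets of $X$, and the cellularity $c(X)$ is the supremum of the cardinalities of the cellular families in $X$. *)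

theory Defs
  imports "HOL-Analysis.Analysis"
begin

unbundle cardinal_syntax

text \<open>Preorders and cardinals are reflexive relations of type \<^typ>\<open>'a rel\<close> carried by their
  \<^const>\<open>Field\<close>; cardinals are the well-orders satisfying \<^const>\<open>Card_order\<close>.\<close>

definition Nbhd :: "'a \<Rightarrow> 'a topology \<Rightarrow> 'a set set" where
  "Nbhd p X = {U. U \<subseteq> topspace X \<and> p \<in> X interior_of U}"

text \<open>Smaller neighborhoods are greater.\<close>
definition Nbhd_order :: "'a \<Rightarrow> 'a topology \<Rightarrow> 'a set rel" where
  "Nbhd_order p X = {(U, V). U \<in> Nbhd p X \<and> V \<in> Nbhd p X \<and> U \<supseteq> V}"

definition prod_order :: "'i set \<Rightarrow> ('i \<Rightarrow> 'k rel) \<Rightarrow> ('i \<Rightarrow> 'k) rel" where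
  "prod_order I r = {(f, g). f \<in> (\<Pi>\<^sub>E i\<in>I. Field (r i)) \<and> g \<in> (\<Pi>\<^sub>E i\<in>I. Field (r i)) \<and>
                            (\<forall>i\<in>I. (f i, g i) \<in> r i)}"

lemma Preorder_Nbhd_order:
  "Field (Nbhd_order p X) = Nbhd p X" "Preorder (Nbhd_order p X)"
proof -
  show F: "Field (Nbhd_order p X) = Nbhd p X"
    by (auto simp: Nbhd_order_def Field_def)
  show "Preorder (Nbhd_order p X)"
    unfolding F by (auto simp: Nbhd_order_def preorder_on_def refl_on_def trans_def)
qed

lemma Preorder_prod_order:
  assumes "\<And>i. i \<in> I \<Longrightarrow> Preorder (r i)"
  shows "Field (prod_order I r) = (\<Pi>\<^sub>E i\<in>I. Field (r i))" "Preorder (prod_order I r)"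
proof -
  have refl: "(x, x) \<in> r i" if "i \<in> I" "x \<in> Field (r i)" for i x
    using assms[OF that(1)] that(2) by (auto simp: preorder_on_def refl_on_def)
  have "(f, f) \<in> prod_order I r" if "f \<in> (\<Pi>\<^sub>E i\<in>I. Field (r i))" for f
    using that refl by (auto simp: prod_order_def PiE_iff)
  then show F: "Field (prod_order I r) = (\<Pi>\<^sub>E i\<in>I. Field (r i))"
    by (auto simp: prod_order_def Field_def)
  have "trans (prod_order I r)"
    using assms unfolding prod_order_def preorder_on_def trans_def by blast
  moreover have "refl_on (Field (prod_order I r)) (prod_order I r)"
    unfolding F using refl by (auto simp: refl_on_def prod_order_def PiE_iff)
  ultimately show "Preorder (prod_order I r)"
    by (auto simp: preorder_on_def Field_def)
qed

text \<open>Weak cofinality; the library's \<^const>\<open>cofinal\<close> demands strictly larger elements.\<close>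
definition cofinal_subset :: "'a set \<Rightarrow> 'a rel \<Rightarrow> bool" where
  "cofinal_subset C R \<longleftrightarrow> C \<subseteq> Field R \<and> (\<forall>x\<in>Field R. \<exists>c\<in>C. (x, c) \<in> R)"

definition common_cofinal_extension :: "'c rel \<Rightarrow> 'a rel \<Rightarrow> 'b rel \<Rightarrow> bool" where
  "common_cofinal_extension R P Q \<longleftrightarrow> Preorder R \<and>
     (\<exists>C D f g. cofinal_subset C R \<and> cofinal_subset D R \<and>
                iso P (Restr R C) f \<and> iso Q (Restr R D) g)"

text \<open>The witnessing preorder may be any preorder on any type; fixing its type to be the sum type
  loses nothing, see \<open>cofinally_equivalentI\<close>.\<close>
definition cofinally_equivalent :: "'a rel \<Rightarrow> 'b rel \<Rightarrow> bool" where
  "cofinally_equivalent P Q \<longleftrightarrow> (\<exists>R :: ('a + 'b) rel. common_cofinal_extension R P Q)"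

lemma Field_Restr_Preorder:
  assumes "Preorder R" "C \<subseteq> Field R"
  shows "Field (Restr R C) = C"
  using assms by (fastforce simp: preorder_on_def refl_on_def Field_def)

lemma cofinally_equivalentI:
  fixes P :: "'a rel" and Q :: "'b rel" and R :: "'c rel"
  assumes "common_cofinal_extension R P Q"
  shows "cofinally_equivalent P Q"
proof -
  from assms obtain C D f g where R: "Preorder R"
    and C: "cofinal_subset C R" and D: "cofinal_subset D R"
    and f: "iso P (Restr R C) f" and g: "iso Q (Restr R D) g"
    unfolding common_cofinal_extension_def by blast
  have CF: "C \<subseteq> Field R" and DF: "D \<subseteq> Field R"
    using C D by (auto simp: cofinal_subset_def)
  have fb: "bij_betw f (Field P) C" and gb: "bij_betw g (Field Q) D"
    using f g Field_Restr_Preorder[OF R CF] Field_Restr_Preorder[OF R DF] by (auto simp: iso_def)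
  have fo: "(a, b) \<in> P \<longleftrightarrow> (f a, f b) \<in> R" if "a \<in> Field P" "b \<in> Field P" for a b
    using f that fb by (auto simp: iso_iff2 bij_betw_def)
  have go: "(a, b) \<in> Q \<longleftrightarrow> (g a, g b) \<in> R" if "a \<in> Field Q" "b \<in> Field Q" for a b
    using g that gb by (auto simp: iso_iff2 bij_betw_def)
  define h where "h = case_sum f g"
  define S where "S = Inl ` Field P \<union> Inr ` Field Q"
  define T where "T = {(x, y). x \<in> S \<and> y \<in> S \<and> (h x, h y) \<in> R}"
  have hS: "h x \<in> Field R" if "x \<in> S" for x
    using that fb gb CF DF by (auto simp: S_def h_def bij_betw_def)
  have reflR: "(x, x) \<in> R" if "x \<in> Field R" for x
    using R that by (auto simp: preorder_on_def refl_on_def)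
  have FT: "Field T = S"
    using hS reflR by (auto simp: T_def Field_def)
  have T: "Preorder T"
    unfolding FT preorder_on_def
    using R hS reflR by (auto simp: T_def refl_on_def trans_def preorder_on_def)
  have cof1: "cofinal_subset (Inl ` Field P) T"
    unfolding cofinal_subset_def FT
  proof (intro conjI ballI)
    fix x assume "x \<in> S"
    then obtain c where "c \<in> C" "(h x, c) \<in> R"
      using C hS[OF \<open>x \<in> S\<close>] unfolding cofinal_subset_def by blast
    moreover obtain a where "a \<in> Field P" "f a = c"
      using fb \<open>c \<in> C\<close> by (auto simp: bij_betw_def)
    ultimately have "(x, Inl a) \<in> T"
      using \<open>x \<in> S\<close> by (auto simp: T_def S_def h_def)
    then show "\<exists>c\<in>Inl ` Field P. (x, c) \<in> T"
      using \<open>a \<in> Field P\<close> by blast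
  qed (auto simp: S_def)
  have cof2: "cofinal_subset (Inr ` Field Q) T"
    unfolding cofinal_subset_def FT
  proof (intro conjI ballI)
    fix x assume "x \<in> S"
    then obtain c where "c \<in> D" "(h x, c) \<in> R"
      using D hS[OF \<open>x \<in> S\<close>] unfolding cofinal_subset_def by blast
    moreover obtain a where "a \<in> Field Q" "g a = c"
      using gb \<open>c \<in> D\<close> by (auto simp: bij_betw_def)
    ultimately have "(x, Inr a) \<in> T"
      using \<open>x \<in> S\<close> by (auto simp: T_def S_def h_def)
    then show "\<exists>c\<in>Inr ` Field Q. (x, c) \<in> T"
      using \<open>a \<in> Field Q\<close> by blast
  qed (auto simp: S_def)
  have F1: "Field (Restr T (Inl ` Field P)) = Inl ` Field P"
    and F2: "Field (Restr T (Inr ` Field Q)) = Inr ` Field Q"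
    using Field_Restr_Preorder[OF T] cof1 cof2 by (auto simp: cofinal_subset_def)
  have "iso P (Restr T (Inl ` Field P)) Inl"
    unfolding iso_iff2 F1 using fo by (auto simp: T_def S_def h_def bij_betw_def)
  moreover have "iso Q (Restr T (Inr ` Field Q)) Inr"
    unfolding iso_iff2 F2 using go by (auto simp: T_def S_def h_def bij_betw_def)
  ultimately show ?thesis
    unfolding cofinally_equivalent_def common_cofinal_extension_def using T cof1 cof2 by blast
qed

text \<open>The only finite regular cardinal is 1. The infinity requirement is needed because
  \<^const>\<open>regularCard\<close> holds vacuously of every finite nonzero cardinal.\<close>
definition regular_cardinal :: "'k rel \<Rightarrow> bool" where
  "regular_cardinal r \<longleftrightarrow> Card_order r \<and> (cinfinite r \<and> regularCard r \<or> r =o BNF_Cardinal_Arithmetic.cone)"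

definition cellular_family :: "'a topology \<Rightarrow> 'a set set \<Rightarrow> bool" where
  "cellular_family X A \<longleftrightarrow> (\<forall>U\<in>A. openin X U) \<and> pairwise disjnt A"

definition cardinality_bound :: "'a set set \<Rightarrow> 'b rel \<Rightarrow> bool" where
  "cardinality_bound F r \<longleftrightarrow> Card_order r \<and> (\<forall>A\<in>F. |A| \<le>o r)"

text \<open>The supremum of the cardinalities of cellular families; it exists, is unique up to
  isomorphism, and is least among the upper bounds on all types, see \<open>cellularity_bound\<close> and
  \<open>cellularity_least\<close>.\<close>
definition cellularity :: "'a topology \<Rightarrow> 'a set rel" where
  "cellularity X = (SOME r. cardinality_bound {A. cellular_family X A} r \<and>
     (\<forall>s :: 'a set rel. cardinality_bound {A. cellular_family X A} s \<longrightarrow> r \<le>o s))"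

lemma cellularity_aux:
  fixes X :: "'a topology"
  shows "cardinality_bound {A. cellular_family X A} (cellularity X) \<and>
    (\<forall>s :: 'a set rel. cardinality_bound {A. cellular_family X A} s \<longrightarrow> cellularity X \<le>o s)"
proof -
  let ?B = "{r :: 'a set rel. cardinality_bound {A. cellular_family X A} r}"
  have "|UNIV :: 'a set set| \<in> ?B"
    by (auto simp: cardinality_bound_def card_of_mono1 card_of_Card_order)
  then have "\<exists>r\<in>?B. \<forall>s\<in>?B. r \<le>o s"
    by (intro exists_minim_Card_order) (auto simp: cardinality_bound_def)
  then have "\<exists>r :: 'a set rel. cardinality_bound {A. cellular_family X A} r \<and>
     (\<forall>s :: 'a set rel. cardinality_bound {A. cellular_family X A} s \<longrightarrow> r \<le>o s)"
    by simp
  then show ?thesis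
    unfolding cellularity_def by (rule someI_ex)
qed

lemma cellularity_bound:
  "Card_order (cellularity X)" "cellular_family X A \<Longrightarrow> |A| \<le>o cellularity X"
  using cellularity_aux[of X] by (auto simp: cardinality_bound_def)

lemma cellularity_least:
  fixes X :: "'a topology" and s :: "'b rel"
  assumes "Card_order s" "\<And>A. cellular_family X A \<Longrightarrow> |A| \<le>o s"
  shows "cellularity X \<le>o s"
proof (cases "s \<le>o cellularity X")
  case True
  then have "|Field s| \<le>o |UNIV :: 'a set set|"
    by (rule ordLeq_transitive[OF card_of_mono2 card_of_mono1[OF subset_UNIV]])
  then obtain h :: "'b \<Rightarrow> 'a set" where "inj_on h (Field s)"
    using card_of_ordLeq[of "Field s" "UNIV :: 'a set set"] by blast
  then have "|h ` Field s| =o |Field s|"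
    using ordIso_symmetric[OF card_of_ordIsoI[OF inj_on_imp_bij_betw]] by simp
  then have s: "|h ` Field s| =o s"
    using card_of_Field_ordIso[OF assms(1)] by (rule ordIso_transitive)
  then have "cardinality_bound {A. cellular_family X A} |h ` Field s|"
    unfolding cardinality_bound_def
    using ordLeq_ordIso_trans[OF assms(2) ordIso_symmetric[OF s]] card_of_Card_order by blast
  then have "cellularity X \<le>o |h ` Field s|"
    using cellularity_aux[of X] by simp
  then show ?thesis
    using s by (rule ordLeq_ordIso_trans)
next
  case False
  then show ?thesis
    using ordLeq_total[OF card_order_on_well_order_on[OF assms(1)]
        card_order_on_well_order_on[OF cellularity_bound(1)[of X]]] by simp
qed

end

theory Submission
  imports Defs
begin

text \<open>
  Let \<open>\<kappa> = \<kappa>\<^sub>n\<close> be infinite and let \<open>P\<close> be the product of the smaller factors. As \<open>\<kappa>\<close> is infinite and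
  \<open>n\<close> is finite, \<open>|P| < \<kappa>\<close>, so whenever \<open>\<kappa>\<close> is covered by sets indexed by \<open>P\<close>, one of them is
  cofinal in \<open>\<kappa>\<close> (\<open>regular_pigeonhole\<close>). (If \<open>\<kappa>\<close> is finite, it is \<open>1\<close>, and the family
  consisting of the whole space suffices.)

  Cofinal equivalence yields maps \<open>F\<close> from the product to the neighborhoods of \<open>p\<close> and \<open>G\<close> back such
  that \<open>x \<ge> G U\<close> implies \<open>F x \<subseteq> U\<close>, and \<open>U \<subseteq> F x\<close> implies \<open>x \<le> G U\<close>
  (\<open>cofinally_equivalent_Tukey\<close>). Let \<open>E a \<alpha>\<close> be the union of the interiors of all \<open>F x\<close> with
  \<open>x \<ge> (a, \<alpha>)\<close>. By the first implication these open sets form a local base at \<open>p\<close>, and for each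
  \<open>a \<in> P\<close> they descend as \<open>\<alpha>\<close> grows: the base is a union of fewer than \<open>\<kappa>\<close> descending
  \<open>\<kappa>\<close>-chains. By the second implication, for a fixed \<open>z \<in> P\<close>, the neighborhoods
  \<open>V \<alpha> = F (z, \<alpha>)\<close> have the property that no neighborhood of \<open>p\<close> is contained in cofinally many
  of them.

  These two properties produce \<open>\<kappa>\<close> disjoint open sets (\<open>cellularity_ge_few_chains\<close>). The pigeonhole
  principle gives a chain \<open>E a\<close> with members inside cofinally many \<open>V \<delta>\<close>, and, by regularity of
  the space, a second chain \<open>E b\<close> such that every member of \<open>E a\<close> contains the closure of a member
  of \<open>E b\<close>. If some \<open>E b \<alpha>\<close> were contained in the closures of all \<open>E b \<beta>\<close>, it would be
  contained in every member of \<open>E a\<close>, hence in cofinally many \<open>V \<delta>\<close>, which is impossible. So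
  the chain \<open>E b\<close> keeps dropping even after taking closures, and differences of the form
  \<open>E b \<alpha> - closure (E b \<beta>)\<close> provide the cellular family (\<open>cellularity_ge_descending_chain\<close>).
\<close>

section \<open>Regular and infinite cardinals\<close>

lemma not_cofinal_bounded:
  assumes "Card_order r" "K \<subseteq> Field r" "\<not> cofinal K r"
  shows "\<exists>\<gamma>\<in>Field r. \<forall>b\<in>K. (b, \<gamma>) \<in> r"
proof -
  have w: "Well_order r" using assms(1) by (rule card_order_on_well_order_on)
  have tot: "(a, b) \<in> r \<or> (b, a) \<in> r" if "a \<in> Field r" "b \<in> Field r" for a b
    using wo_rel.TOTALS[of r] w that by (auto simp: wo_rel_def)
  obtain \<gamma> where \<gamma>: "\<gamma> \<in> Field r" "\<forall>b\<in>K. \<gamma> = b \<or> (\<gamma>, b) \<notin> r"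
    using assms(3) unfolding cofinal_def by blast
  have "(b, \<gamma>) \<in> r" if "b \<in> K" for b
    using \<gamma> that tot[of b \<gamma>] tot[of \<gamma> \<gamma>] assms(2) by (metis subsetD)
  then show ?thesis using \<gamma>(1) by blast
qed

lemma small_bounded:
  assumes "Card_order r" "regularCard r" "|P| <o r" "f ` P \<subseteq> Field r"
  shows "\<exists>\<gamma>\<in>Field r. \<forall>a\<in>P. (f a, \<gamma>) \<in> r"
proof -
  have "|f ` P| <o r" using card_of_image assms(3) by (rule ordLeq_ordLess_trans)
  then have "\<not> cofinal (f ` P) r"
    using assms(2,4) not_ordLess_ordIso unfolding regularCard_def by blast
  then show ?thesis using not_cofinal_bounded[OF assms(1,4)] by blast
qed

text \<open>If no \<open>T a\<close> were cofinal, each would have a bound; these fewer than \<open>r\<close> bounds would have a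
  common bound, which would be a largest element of \<open>r\<close>.\<close>
lemma regular_pigeonhole:
  assumes r: "Card_order r" "regularCard r" "\<not> finite (Field r)"
    and P: "|P| <o r" and cover: "\<And>\<alpha>. \<alpha> \<in> Field r \<Longrightarrow> \<exists>a\<in>P. \<alpha> \<in> T a"
  shows "\<exists>a\<in>P. cofinal (T a \<inter> Field r) r"
proof (rule ccontr)
  assume "\<not> ?thesis"
  then have "\<forall>a\<in>P. \<exists>\<gamma>\<in>Field r. \<forall>b\<in>T a \<inter> Field r. (b, \<gamma>) \<in> r"
    using not_cofinal_bounded[OF r(1)] by blast
  then obtain c where "\<forall>a\<in>P. c a \<in> Field r \<and> (\<forall>b\<in>T a \<inter> Field r. (b, c a) \<in> r)"
    unfolding Bex_def by (auto dest: bchoice)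
  then have c: "\<And>a. a \<in> P \<Longrightarrow> c a \<in> Field r"
    "\<And>a b. a \<in> P \<Longrightarrow> b \<in> T a \<Longrightarrow> b \<in> Field r \<Longrightarrow> (b, c a) \<in> r"
    by auto
  obtain \<gamma> where \<gamma>: "\<gamma> \<in> Field r" "\<forall>a\<in>P. (c a, \<gamma>) \<in> r"
    using small_bounded[OF r(1,2) P, of c] c(1) by blast
  obtain \<delta> where \<delta>: "\<delta> \<in> Field r" "\<gamma> \<noteq> \<delta>" "(\<gamma>, \<delta>) \<in> r"
    using infinite_Card_order_limit[OF r(1,3) \<gamma>(1)] by blast
  have w: "Well_order r" using r(1) by (rule card_order_on_well_order_on)
  obtain a where "a \<in> P" "\<delta> \<in> T a" using cover \<delta>(1) by blast
  then have "(\<delta>, \<gamma>) \<in> r"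
    using c(2) \<gamma>(2) \<delta>(1) w by (meson transD wo_rel.TRANS wo_rel.intro)
  then show False
    using \<delta> w by (meson antisymD wo_rel.ANTISYM wo_rel.intro)
qed

lemma finite_less_infinite_Card_order:
  assumes "finite A" "\<not> finite (Field r)" "Card_order r"
  shows "|A| <o r"
  by (rule Cfinite_ordLess_Cinfinite)
    (use assms in \<open>simp_all add: cfinite_def cinfinite_def card_of_card_order_on Field_card_of\<close>)

text \<open>The disjoint sum dominates both factors and stays below \<open>r\<close>; if it is infinite, it also
  dominates the product.\<close>
lemma card_Times_less_infinite:
  assumes r: "\<not> finite (Field r)" "Card_order r" and A: "|A| <o r" and B: "|B| <o r"
  shows "|A \<times> B| <o r"
proof (cases "finite (A <+> B)")
  case True
  then show ?thesis
    by (intro finite_less_infinite_Card_order r) (simp add: finite_Plus_iff)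
next
  case False
  then have "|A \<times> B| \<le>o |A <+> B|"
    by (intro card_of_Times_ordLeq_infinite_Field)
      (auto simp: Field_card_of card_of_Plus1 card_of_Plus2 card_of_card_order_on)
  then show ?thesis
    using card_of_Plus_ordLess_infinite_Field[OF r A B] by (rule ordLeq_ordLess_trans)
qed

lemma card_PiE_lessThan_less:
  assumes r: "\<not> finite (Field r)" "Card_order r"
    and small: "\<And>i. i < (n :: nat) \<Longrightarrow> |A i| <o r"
  shows "|\<Pi>\<^sub>E i\<in>{..<n}. A i| <o r"
  using small
proof (induction n)
  case 0
  then show ?case
    by (intro finite_less_infinite_Card_order r) simp
next
  case (Suc n)
  have "|A n \<times> (\<Pi>\<^sub>E i\<in>{..<n}. A i)| <o r"
    using Suc r by (intro card_Times_less_infinite) auto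
  then show ?case
    unfolding lessThan_Suc PiE_insert_eq using card_of_image by (rule ordLeq_ordLess_trans[rotated])
qed

section \<open>Tukey maps between cofinally equivalent preorders\<close>

text \<open>Both preorders sit cofinally in a common one, so an element of either can be sent to some
  element of the other lying above it; both implications are then transitivity in the common
  preorder.\<close>
lemma cofinally_equivalent_Tukey:
  assumes "cofinally_equivalent P Q"
  obtains F G where "\<And>x. x \<in> Field Q \<Longrightarrow> F x \<in> Field P" "\<And>u. u \<in> Field P \<Longrightarrow> G u \<in> Field Q"
    "\<And>x u. x \<in> Field Q \<Longrightarrow> u \<in> Field P \<Longrightarrow> (G u, x) \<in> Q \<Longrightarrow> (u, F x) \<in> P"
    "\<And>x u. x \<in> Field Q \<Longrightarrow> u \<in> Field P \<Longrightarrow> (F x, u) \<in> P \<Longrightarrow> (x, G u) \<in> Q"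
proof -
  from assms obtain R :: "('a + 'b) rel" and C D f g where R: "Preorder R"
    and C: "cofinal_subset C R" and D: "cofinal_subset D R"
    and f: "iso P (Restr R C) f" and g: "iso Q (Restr R D) g"
    unfolding cofinally_equivalent_def common_cofinal_extension_def by blast
  have CF: "C \<subseteq> Field R" and DF: "D \<subseteq> Field R"
    using C D by (auto simp: cofinal_subset_def)
  have fb: "f ` Field P = C" and gb: "g ` Field Q = D"
    using f g Field_Restr_Preorder[OF R CF] Field_Restr_Preorder[OF R DF]
    by (auto simp: iso_def bij_betw_def)
  have fo: "(a, b) \<in> P \<longleftrightarrow> (f a, f b) \<in> R" if "a \<in> Field P" "b \<in> Field P" for a b
    using f that fb by (auto simp: iso_iff2)
  have go: "(a, b) \<in> Q \<longleftrightarrow> (g a, g b) \<in> R" if "a \<in> Field Q" "b \<in> Field Q" for a b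
    using g that gb by (auto simp: iso_iff2)
  have tr: "(a, c) \<in> R" if "(a, b) \<in> R" "(b, c) \<in> R" for a b c
    using R that by (auto simp: preorder_on_def trans_def)
  have "\<exists>u\<in>Field P. (g x, f u) \<in> R" if "x \<in> Field Q" for x
    using C that fb gb DF unfolding cofinal_subset_def by blast
  then obtain F where F: "\<And>x. x \<in> Field Q \<Longrightarrow> F x \<in> Field P \<and> (g x, f (F x)) \<in> R" by metis
  have "\<exists>x\<in>Field Q. (f u, g x) \<in> R" if "u \<in> Field P" for u
    using D that fb gb CF unfolding cofinal_subset_def by blast
  then obtain G where G: "\<And>u. u \<in> Field P \<Longrightarrow> G u \<in> Field Q \<and> (f u, g (G u)) \<in> R" by metis
  show thesis
  proof (rule that[of F G])
    fix x u assume xu: "x \<in> Field Q" "u \<in> Field P"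
    note Fx = F[OF xu(1)] and Gu = G[OF xu(2)]
    show "(u, F x) \<in> P" if "(G u, x) \<in> Q"
    proof -
      have "(g (G u), g x) \<in> R" using go[of "G u" x] Gu xu(1) that by simp
      then have "(f u, f (F x)) \<in> R" using tr[OF tr] Fx Gu by blast
      then show ?thesis using fo[of u "F x"] Fx xu(2) by simp
    qed
    show "(x, G u) \<in> Q" if "(F x, u) \<in> P"
    proof -
      have "(f (F x), f u) \<in> R" using fo[of "F x" u] Fx xu(2) that by simp
      then have "(g x, g (G u)) \<in> R" using tr[OF tr] Fx Gu by blast
      then show ?thesis using go[of x "G u"] Gu xu(1) by simp
    qed
  qed (use F G in blast)+
qed

section \<open>Cellular families from descending chains\<close>

text \<open>Choosing \<open>h \<alpha>\<close> with \<open>S \<alpha>\<close> not inside the closure of \<open>S (h \<alpha>)\<close>, the nonempty open sets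
  \<open>W \<alpha> = S \<alpha> - closure (S (h \<alpha>))\<close> and \<open>W \<gamma>\<close> are disjoint as soon as \<open>\<gamma> \<ge> h \<alpha>\<close>. A set of
  indices that is maximal with disjoint \<open>W\<close> cannot be small: some \<open>\<gamma>\<close> would bound its image
  under \<open>h\<close>, and could be added.\<close>
lemma cellularity_ge_descending_chain:
  assumes r: "Card_order r" "regularCard r"
    and op: "\<And>\<alpha>. \<alpha> \<in> Field r \<Longrightarrow> openin X (S \<alpha>)"
    and desc: "\<And>\<alpha> \<beta>. (\<alpha>, \<beta>) \<in> r \<Longrightarrow> S \<beta> \<subseteq> S \<alpha>"
    and drop: "\<And>\<alpha>. \<alpha> \<in> Field r \<Longrightarrow> \<exists>\<beta>\<in>Field r. \<not> S \<alpha> \<subseteq> X closure_of S \<beta>"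
  shows "r \<le>o cellularity X"
proof -
  obtain h where h: "\<And>\<alpha>. \<alpha> \<in> Field r \<Longrightarrow> h \<alpha> \<in> Field r \<and> \<not> S \<alpha> \<subseteq> X closure_of S (h \<alpha>)"
    using drop by metis
  define W where "W \<alpha> = S \<alpha> - X closure_of S (h \<alpha>)" for \<alpha>
  have W_open: "openin X (W \<alpha>)" if "\<alpha> \<in> Field r" for \<alpha>
    using op[OF that] unfolding W_def by (simp add: openin_diff)
  have W_nonempty: "W \<alpha> \<noteq> {}" if "\<alpha> \<in> Field r" for \<alpha>
    using h[OF that] by (auto simp: W_def)
  let ?F = "{D. D \<subseteq> Field r \<and> pairwise (\<lambda>\<alpha> \<beta>. disjnt (W \<alpha>) (W \<beta>)) D}"
  have "\<exists>M\<in>?F. \<forall>D\<in>?F. M \<subseteq> D \<longrightarrow> D = M"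
  proof (rule subset_Zorn', goal_cases)
    case (1 c)
    then have "pairwise (\<lambda>\<alpha> \<beta>. disjnt (W \<alpha>) (W \<beta>)) (\<Union>c)"
      by (intro pairwise_chain_Union) (auto simp: subset_chain_def chain_subset_def)
    moreover have "\<Union>c \<subseteq> Field r"
      using 1 by (auto simp: subset_chain_def)
    ultimately show ?case by blast
  qed
  then obtain D where DF: "D \<in> ?F" and D_max: "\<forall>E\<in>?F. D \<subseteq> E \<longrightarrow> E = D"
    by (rule bexE)
  then have D: "D \<subseteq> Field r" "pairwise (\<lambda>\<alpha> \<beta>. disjnt (W \<alpha>) (W \<beta>)) D"
    by simp_all
  have "\<not> |D| <o r"
  proof
    assume "|D| <o r"
    then obtain \<gamma> where \<gamma>: "\<gamma> \<in> Field r" "\<forall>\<alpha>\<in>D. (h \<alpha>, \<gamma>) \<in> r"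
      using small_bounded[OF r, of D h] D(1) h by blast
    have disj: "disjnt (W \<alpha>) (W \<gamma>)" if "\<alpha> \<in> D" for \<alpha>
    proof -
      have "W \<gamma> \<subseteq> S \<gamma>" by (auto simp: W_def)
      also have "\<dots> \<subseteq> S (h \<alpha>)" using \<gamma>(2) that desc by blast
      also have "\<dots> \<subseteq> X closure_of S (h \<alpha>)"
        using closure_of_subset[OF openin_subset[OF op]] h that D(1) by blast
      finally show ?thesis by (auto simp: W_def disjnt_def)
    qed
    then have "insert \<gamma> D \<in> ?F"
      using D \<gamma>(1) by (auto simp: pairwise_insert disjnt_sym)
    \<comment> \<open>By maximality \<open>\<gamma> \<in> D\<close>, so the nonempty \<open>W \<gamma>\<close> would be disjoint from itself.\<close>
    then have "insert \<gamma> D = D"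
      by (rule mp[OF bspec[OF D_max] subset_insertI])
    then have "\<gamma> \<in> D" by (metis insertI1)
    then show False using disj W_nonempty[OF \<gamma>(1)] by (auto simp: disjnt_def)
  qed
  then have "r \<le>o |D|"
    by (rule iffD1[OF not_ordLess_iff_ordLeq[OF card_order_on_well_order_on[OF r(1)] card_of_Well_order]])
  moreover have "inj_on W D"
  proof (rule inj_onI, rule ccontr)
    fix \<alpha> \<beta> assume "\<alpha> \<in> D" "\<beta> \<in> D" "W \<alpha> = W \<beta>" "\<alpha> \<noteq> \<beta>"
    then show False
      using pairwiseD[OF D(2)] W_nonempty D(1) by (metis disjnt_self_iff_empty subsetD)
  qed
  then have "|D| \<le>o |W ` D|"
    by (intro iffD1[OF card_of_ordLeq] exI[of _ W]) simp
  moreover have "cellular_family X (W ` D)"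
    unfolding cellular_family_def
  proof
    show "\<forall>U\<in>W ` D. openin X U" using W_open D(1) by auto
    show "pairwise disjnt (W ` D)" using D(2) by (auto simp: pairwise_def)
  qed
  then have "|W ` D| \<le>o cellularity X" by (rule cellularity_bound)
  ultimately show ?thesis by (meson ordLeq_transitive)
qed

lemma cellularity_ge_one:
  fixes r :: "'k rel"
  assumes "r =o BNF_Cardinal_Arithmetic.cone"
  shows "r \<le>o cellularity X"
proof -
  have "BNF_Cardinal_Arithmetic.cone \<le>o |{topspace X}|"
    unfolding BNF_Cardinal_Arithmetic.cone_def by (simp add: card_of_singl_ordLeq)
  also have "|{topspace X}| \<le>o cellularity X"
    by (rule cellularity_bound) (simp add: cellular_family_def)
  finally show ?thesis using assms by (blast intro: ordIso_ordLeq_trans)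
qed

section \<open>Local bases made of few descending chains\<close>

text \<open>Because \<open>P\<close> is small, what holds for each \<open>\<alpha>\<close> along some chain holds for cofinally many
  \<open>\<alpha>\<close> along one chain. This yields a chain \<open>E a\<close> that gets inside cofinally many \<open>V \<delta>\<close> and a
  chain \<open>E b\<close> whose closures get inside every member of \<open>E a\<close>. The chain \<open>E b\<close> must keep dropping
  modulo closures, since otherwise one of its members would lie in cofinally many \<open>V \<delta>\<close>.\<close>
lemma cellularity_ge_few_chains:
  assumes r: "Card_order r" "regularCard r" "\<not> finite (Field r)" and P: "|P| <o r"
    and reg: "regular_space X"
    and op: "\<And>a \<alpha>. a \<in> P \<Longrightarrow> \<alpha> \<in> Field r \<Longrightarrow> openin X (E a \<alpha>) \<and> p \<in> E a \<alpha>"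
    and desc: "\<And>a \<alpha> \<beta>. a \<in> P \<Longrightarrow> (\<alpha>, \<beta>) \<in> r \<Longrightarrow> E a \<beta> \<subseteq> E a \<alpha>"
    and base: "\<And>U. U \<in> Nbhd p X \<Longrightarrow> \<exists>a\<in>P. \<exists>\<alpha>\<in>Field r. E a \<alpha> \<subseteq> U"
    and V: "\<And>\<alpha>. \<alpha> \<in> Field r \<Longrightarrow> V \<alpha> \<in> Nbhd p X"
    and V_sparse: "\<And>U. U \<in> Nbhd p X \<Longrightarrow> \<exists>\<gamma>\<in>Field r. \<forall>\<alpha>\<in>Field r. U \<subseteq> V \<alpha> \<longrightarrow> (\<alpha>, \<gamma>) \<in> r"
  shows "r \<le>o cellularity X"
proof -
  have w: "wo_rel r" using card_order_on_well_order_on[OF r(1)] by (simp add: wo_rel_def)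
  have open_Nbhd: "U \<in> Nbhd p X" if "openin X U" "p \<in> U" for U
    using that by (simp add: Nbhd_def interior_of_openin openin_subset)
  obtain a where a: "a \<in> P"
    "cofinal ({\<delta>. \<exists>\<alpha>\<in>Field r. E a \<alpha> \<subseteq> V \<delta>} \<inter> Field r) r"
    using regular_pigeonhole[OF r P, of "\<lambda>a. {\<delta>. \<exists>\<alpha>\<in>Field r. E a \<alpha> \<subseteq> V \<delta>}"] base V by blast
  \<comment> \<open>Regularity of the space supplies, for each \<open>\<alpha>\<close>, a chain depending on \<open>\<alpha>\<close>; the pigeonhole
    principle, together with monotonicity of \<open>E a\<close>, makes it the same chain for all \<open>\<alpha>\<close>.\<close>
  have "\<exists>b\<in>P. \<exists>\<beta>\<in>Field r. X closure_of E b \<beta> \<subseteq> E a \<alpha>" if \<alpha>: "\<alpha> \<in> Field r" for \<alpha>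
  proof -
    have "neighbourhood_base_of (closedin X) X"
      using reg by (simp add: neighbourhood_base_of_closedin)
    then have "\<exists>U C. openin X U \<and> closedin X C \<and> p \<in> U \<and> U \<subseteq> C \<and> C \<subseteq> E a \<alpha>"
      using op[OF a(1) \<alpha>] by (simp add: neighbourhood_base_of)
    then obtain U C where U: "openin X U" "closedin X C" "p \<in> U" "U \<subseteq> C" "C \<subseteq> E a \<alpha>"
      by (elim exE conjE)
    obtain b \<beta> where "b \<in> P" "\<beta> \<in> Field r" "E b \<beta> \<subseteq> U"
      using base[OF open_Nbhd[OF U(1,3)]] by blast
    then show ?thesis
      using U closure_of_minimal[of "E b \<beta>" C X] by blast
  qed
  then have "\<exists>b\<in>P. cofinal ({\<alpha>. \<exists>\<beta>\<in>Field r. X closure_of E b \<beta> \<subseteq> E a \<alpha>} \<inter> Field r) r"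
    using regular_pigeonhole[OF r P, of "\<lambda>b. {\<alpha>. \<exists>\<beta>\<in>Field r. X closure_of E b \<beta> \<subseteq> E a \<alpha>}"]
    by simp
  then obtain b where b: "b \<in> P"
    "cofinal ({\<alpha>. \<exists>\<beta>\<in>Field r. X closure_of E b \<beta> \<subseteq> E a \<alpha>} \<inter> Field r) r"
    by (rule bexE)
  have closure_in: "\<exists>\<beta>\<in>Field r. X closure_of E b \<beta> \<subseteq> E a \<alpha>" if \<alpha>: "\<alpha> \<in> Field r" for \<alpha>
  proof -
    obtain \<alpha>' \<beta> where "(\<alpha>, \<alpha>') \<in> r" "\<beta> \<in> Field r" "X closure_of E b \<beta> \<subseteq> E a \<alpha>'"
      using b(2) \<alpha> unfolding cofinal_def by blast
    then show ?thesis using desc[OF a(1)] by (meson order_trans)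
  qed
  show ?thesis
  proof (rule cellularity_ge_descending_chain[OF r(1,2), of X "E b"])
    fix \<alpha> assume \<alpha>: "\<alpha> \<in> Field r"
    show "\<exists>\<beta>\<in>Field r. \<not> E b \<alpha> \<subseteq> X closure_of E b \<beta>"
    proof (rule ccontr)
      assume "\<not> ?thesis"
      then have sub: "E b \<alpha> \<subseteq> E a \<beta>" if "\<beta> \<in> Field r" for \<beta>
        using closure_in[OF that] by blast
      obtain \<gamma> where \<gamma>: "\<gamma> \<in> Field r" "\<forall>\<delta>\<in>Field r. E b \<alpha> \<subseteq> V \<delta> \<longrightarrow> (\<delta>, \<gamma>) \<in> r"
        using V_sparse[OF open_Nbhd] op[OF b(1) \<alpha>] by blast
      obtain \<delta> where \<delta>: "\<delta> \<in> Field r" "\<gamma> \<noteq> \<delta>" "(\<gamma>, \<delta>) \<in> r" "\<exists>\<beta>\<in>Field r. E a \<beta> \<subseteq> V \<delta>"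
        using a(2) \<gamma>(1) unfolding cofinal_def by blast
      then have "(\<delta>, \<gamma>) \<in> r" using \<gamma>(2) sub by blast
      then show False using \<delta> wo_rel.ANTISYM[OF w] by (meson antisymD)
    qed
  qed (use op desc b in auto)
qed

section \<open>Cellularity at a point of product cofinal type\<close>

theorem theorem2p2:
  fixes n :: nat
    and \<kappa> :: "nat \<Rightarrow> 'k rel"
    and X :: "'a topology"
    and p :: 'a
  assumes "\<And>i. i \<le> n \<Longrightarrow> regular_cardinal (\<kappa> i)"
    and "\<And>i j. i < j \<Longrightarrow> j \<le> n \<Longrightarrow> \<kappa> i <o \<kappa> j"
    and "regular_space X" and "Hausdorff_space X"
    and "p \<in> topspace X"
    and "cofinally_equivalent (Nbhd_order p X) (prod_order {..n} \<kappa>)"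
  shows "\<kappa> n \<le>o cellularity X"
proof (cases "\<kappa> n =o BNF_Cardinal_Arithmetic.cone")
  case True
  then show ?thesis by (rule cellularity_ge_one)
next
  case False
  then have r: "Card_order (\<kappa> n)" "regularCard (\<kappa> n)" "\<not> finite (Field (\<kappa> n))"
    using assms(1)[of n] by (auto simp: regular_cardinal_def cinfinite_def)
  have card: "Card_order (\<kappa> i)" if "i \<le> n" for i
    using assms(1)[OF that] by (simp add: regular_cardinal_def)
  have pre: "Preorder (\<kappa> i)" if "i \<le> n" for i
    using card_order_on_well_order_on[OF card[OF that]]
    by (simp add: well_order_on_def linear_order_on_def partial_order_on_def)
  \<comment> \<open>A point of the product is written as \<open>a(n := \<alpha>)\<close>, with \<open>a\<close> in the product \<open>P\<close> of the
    smaller factors and \<open>\<alpha>\<close> in the largest one.\<close>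
  define P where "P = (\<Pi>\<^sub>E i\<in>{..<n}. Field (\<kappa> i))"
  define Q where "Q = prod_order {..n} \<kappa>"
  have FQ: "Field Q = (\<Pi>\<^sub>E i\<in>{..n}. Field (\<kappa> i))" and preQ: "Preorder Q"
    unfolding Q_def using Preorder_prod_order[of "{..n}" \<kappa>] pre by auto
  have reflQ: "(x, x) \<in> Q" if "x \<in> Field Q" for x
    using preQ that by (auto simp: preorder_on_def refl_on_def)
  have transQ: "(x, z) \<in> Q" if "(x, y) \<in> Q" "(y, z) \<in> Q" for x y z
    using preQ that by (auto simp: preorder_on_def trans_def)
  have upd: "a(n := \<alpha>) \<in> Field Q" if "a \<in> P" "\<alpha> \<in> Field (\<kappa> n)" for a \<alpha>
    using that unfolding FQ P_def by (auto simp: PiE_iff extensional_def)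
  have upd_mono: "(a(n := \<alpha>), a(n := \<beta>)) \<in> Q" if "a \<in> P" "(\<alpha>, \<beta>) \<in> \<kappa> n" for a \<alpha> \<beta>
  proof -
    have "a(n := \<alpha>) \<in> Field Q" "a(n := \<beta>) \<in> Field Q"
      using upd[OF that(1)] that(2) by (auto simp: Field_def)
    moreover have "(a i, a i) \<in> \<kappa> i" if "i \<le> n" "i \<noteq> n" for i
      using \<open>a \<in> P\<close> pre[OF that(1)] that
      by (auto simp: P_def PiE_iff preorder_on_def refl_on_def)
    ultimately show ?thesis
      using that(2) unfolding FQ unfolding Q_def prod_order_def by simp
  qed
  have split: "\<exists>a\<in>P. \<exists>\<alpha>\<in>Field (\<kappa> n). x = a(n := \<alpha>)" if "x \<in> Field Q" for x
  proof (intro bexI)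
    show "x = (restrict x {..<n})(n := x n)" "restrict x {..<n} \<in> P" "x n \<in> Field (\<kappa> n)"
      using that unfolding FQ P_def by (auto simp: PiE_iff extensional_def)
  qed
  have small: "|P| <o \<kappa> n"
    unfolding P_def
  proof (rule card_PiE_lessThan_less[OF r(3,1)])
    fix i assume "i < n"
    then show "|Field (\<kappa> i)| <o \<kappa> n"
      using assms(2)[of i n] card_of_Field_ordIso[OF card[of i]] ordIso_ordLess_trans by auto
  qed
  obtain F G where F: "\<And>x. x \<in> Field Q \<Longrightarrow> F x \<in> Nbhd p X"
    and G: "\<And>u. u \<in> Nbhd p X \<Longrightarrow> G u \<in> Field Q"
    and GF: "\<And>x u. x \<in> Field Q \<Longrightarrow> u \<in> Nbhd p X \<Longrightarrow> (G u, x) \<in> Q \<Longrightarrow> F x \<subseteq> u"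
    and FG: "\<And>x u. x \<in> Field Q \<Longrightarrow> u \<in> Nbhd p X \<Longrightarrow> u \<subseteq> F x \<Longrightarrow> (x, G u) \<in> Q"
  proof (rule cofinally_equivalent_Tukey[OF assms(6), folded Q_def], goal_cases)
    case (1 F G)
    note FG = 1(2-5)[unfolded Preorder_Nbhd_order]
    show thesis
    proof (rule that[of F G])
      fix x u assume xu: "x \<in> Field Q" "u \<in> Nbhd p X"
      show "F x \<subseteq> u" if "(G u, x) \<in> Q"
        using FG(3)[OF xu that] by (simp add: Nbhd_order_def)
      show "(x, G u) \<in> Q" if "u \<subseteq> F x"
        using FG(4)[OF xu] FG(1)[OF xu(1)] xu(2) that by (simp add: Nbhd_order_def)
    qed (fact FG)+
  qed
  \<comment> \<open>Taking the union over all larger points makes the family monotone, although \<open>F\<close> need not be,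
    and keeps \<open>E a \<alpha> \<subseteq> U\<close> whenever \<open>a(n := \<alpha>)\<close> lies above \<open>G U\<close>.\<close>
  define E where "E a \<alpha> = (\<Union>x\<in>Q `` {a(n := \<alpha>)}. X interior_of F x)" for a \<alpha>
  have inQ: "x \<in> Field Q" if "(y, x) \<in> Q" for x y using that by (auto simp: Field_def)
  have "topspace X \<in> Nbhd p X" using assms(5) by (simp add: Nbhd_def)
  then obtain z where z: "z \<in> P" using split[OF G] by blast
  show ?thesis
  proof (rule cellularity_ge_few_chains[OF r small assms(3), of E p "\<lambda>\<alpha>. F (z(n := \<alpha>))"])
    fix a \<alpha> assume "a \<in> P" "\<alpha> \<in> Field (\<kappa> n)"
    then have "(a(n := \<alpha>), a(n := \<alpha>)) \<in> Q" using reflQ upd by blast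
    moreover have "p \<in> X interior_of F (a(n := \<alpha>))"
      using F[OF inQ[OF calculation]] by (simp add: Nbhd_def)
    ultimately show "openin X (E a \<alpha>) \<and> p \<in> E a \<alpha>"
      unfolding E_def by (auto simp del: fun_upd_apply)
  next
    fix a \<alpha> \<beta> assume "a \<in> P" "(\<alpha>, \<beta>) \<in> \<kappa> n"
    then have "(a(n := \<alpha>), x) \<in> Q" if "(a(n := \<beta>), x) \<in> Q" for x
      using transQ[OF upd_mono that] by simp
    then show "E a \<beta> \<subseteq> E a \<alpha>"
      unfolding E_def by (intro UN_mono) auto
  next
    fix U assume U: "U \<in> Nbhd p X"
    obtain a \<alpha> where a: "a \<in> P" "\<alpha> \<in> Field (\<kappa> n)" "G U = a(n := \<alpha>)"
      using split[OF G[OF U]] by blast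
    have "E a \<alpha> \<subseteq> U"
      unfolding E_def a(3)[symmetric]
    proof (rule UN_least)
      fix x assume "x \<in> Q `` {G U}"
      then have "F x \<subseteq> U" using GF[OF inQ U] by simp
      then show "X interior_of F x \<subseteq> U" using interior_of_subset[of X "F x"] by simp
    qed
    then show "\<exists>a\<in>P. \<exists>\<alpha>\<in>Field (\<kappa> n). E a \<alpha> \<subseteq> U" using a by blast
  next
    fix \<alpha> assume "\<alpha> \<in> Field (\<kappa> n)"
    then show "F (z(n := \<alpha>)) \<in> Nbhd p X" using F upd z by blast
  next
    fix U assume U: "U \<in> Nbhd p X"
    have "(\<alpha>, G U n) \<in> \<kappa> n" if "\<alpha> \<in> Field (\<kappa> n)" "U \<subseteq> F (z(n := \<alpha>))" for \<alpha>
      using FG[OF upd[OF z that(1)] U that(2)] unfolding Q_def prod_order_def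
      by (auto dest!: bspec[where x = n])
    moreover have "G U n \<in> Field (\<kappa> n)" using G[OF U] unfolding FQ by auto
    ultimately show "\<exists>\<gamma>\<in>Field (\<kappa> n). \<forall>\<alpha>\<in>Field (\<kappa> n). U \<subseteq> F (z(n := \<alpha>)) \<longrightarrow> (\<alpha>, \<gamma>) \<in> \<kappa> n"
      by blast
  qed
qed

end
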